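(* Let $\bm p_0,\dots,\bm p_{m-1}$ be distinct points in $\mathbb{R}^d$ whose convex hull $\Omega$ has dimension $d$. Then there exists $\lambda_0<1$ such that for every $\lambda\in(\lambda_0,1)$ the following hold: (1) $S_\lambda=\Omega$; (2) each point $\bm x\in\Omega$ which is not a vertex of $\Omega$ has $2^{\aleph_0}$ distinct addresses.
   Context: For $\lambda\in(0,1)$ put $f_j(\bm x)=\lambda\bm x+(1-\lambda)\bm p_j$ for $\bm x\in\mathbb{R}^d$, $j=0,\dots,m-1$. The attractor $S_\lambda$ is the unique nonempty compact set with $S_\lambda=\bigcup_{j=0}^{m-1}f_j(S_\lambda)$. An address of $\bm x\in S_\lambda$ (for the given $\lambda$) is a sequence $(i_1,i_2,\dots)\in\{0,\dots,m-1\}^{\mathbb{N}}$ such that $\bm x=\lim_{n\to\infty}f_{i_1}\cdots f_{i_n}(\bm x_0)$, where $\bm x_0\in\mathbb{R}^d$ is arbitrary (the limit does not depend on $\bm x_0$); equivalently $\bm x=(\lambda^{-1}-1)\sum_{n=1}^\infty\lambda^n\bm p_{i_n}$. $\Omega=\mathrm{conv}(\bm p_0,\dots,\bm p_{m-1})$. *)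

theory Defs
  imports "HOL-Analysis.Analysis" "HOL-Library.Equipollence"
begin

definition ifs_map :: "(nat \<Rightarrow> 'a::real_vector) \<Rightarrow> real \<Rightarrow> nat \<Rightarrow> 'a \<Rightarrow> 'a" where
  "ifs_map p lam j x = lam *\<^sub>R x + (1 - lam) *\<^sub>R p j"

text \<open>The attractor is the unique nonempty compact fixed set; the description operator is
  meaningful for \<open>0 < lam < 1\<close> and \<open>m > 0\<close>, where existence and uniqueness hold.\<close>

definition attractor :: "nat \<Rightarrow> (nat \<Rightarrow> 'a::real_normed_vector) \<Rightarrow> real \<Rightarrow> 'a set" where
  "attractor m p lam =
     (THE S. compact S \<and> S \<noteq> {} \<and> S = (\<Union>j<m. ifs_map p lam j ` S))"

text \<open>Sequences are indexed from \<open>0\<close>: the digit \<open>i k\<close> is the \<open>(k+1)\<close>-st digit of the address,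
  so \<open>ifs_comp p lam i n\<close> is \<open>f\<close> at \<open>i 0\<close> composed with ... composed with \<open>f\<close> at \<open>i (n - 1)\<close>,
  the last of these maps being applied first.\<close>

primrec ifs_comp :: "(nat \<Rightarrow> 'a::real_vector) \<Rightarrow> real \<Rightarrow> (nat \<Rightarrow> nat) \<Rightarrow> nat \<Rightarrow> 'a \<Rightarrow> 'a" where
  "ifs_comp p lam i 0 = id"
| "ifs_comp p lam i (Suc n) = ifs_comp p lam i n \<circ> ifs_map p lam (i n)"

definition is_address ::
    "nat \<Rightarrow> (nat \<Rightarrow> 'a::real_normed_vector) \<Rightarrow> real \<Rightarrow> 'a \<Rightarrow> (nat \<Rightarrow> nat) \<Rightarrow> bool" where
  "is_address m p lam x i \<longleftrightarrow>
     (\<forall>k. i k < m) \<and> (\<forall>x0. (\<lambda>n. ifs_comp p lam i n x0) \<longlonglongrightarrow> x)"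

end

theory Submission
  imports Defs
begin

text \<open>
  Let \<open>V\<close> be the set of vertices of \<open>\<Omega>\<close>, so that \<open>\<Omega> = convex hull V\<close>. All
  geometry can be moved to the simplex of barycentric weights on \<open>V\<close>: if
  \<open>x = (\<Sum>v\<in>V. a v *\<^sub>R v)\<close>, then any sequence of digits in \<open>V\<close> in which each \<open>v\<close> occupies a set
  of positions of total weight \<open>a v\<close>, the position \<open>k\<close> weighing \<open>(1 - lam) * lam ^ k\<close>, is an address
  of \<open>x\<close>. The problem is thus to split the geometric series into parts with prescribed sums.

  One splitting comes from a greedy choice: give each position to a digit whose outstanding demand
  is largest. This works for any nonnegative weights such that \<open>card V\<close> times each weight is at most
  the total of the weights from that position on, since the largest demand is at least the average
  demand (\<open>greedy_partition_of_series\<close>).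

  To get continuum many splittings, reserve a sparse set of free positions, far out in the sequence.
  A point which is not a vertex has two vertices \<open>u \<noteq> v\<close> of positive weight, whichever weights
  represent it; let an arbitrary set \<open>B\<close> of naturals decide which free positions receive \<open>u\<close> and
  which receive \<open>v\<close>. If the free positions have small total weight, neither digit is overspent, and
  the greedy choice on the other positions meets the remaining demands: as no two consecutive
  positions are free, these still carry at least half of every tail of the series that begins at
  one of them. For this \<open>1 - lam \<le> 1 / (2 * card V)\<close> suffices, whatever the point
  (\<open>exists_injective_family_of_digit_sequences\<close>). The set \<open>B\<close> can be read off the digits, so the
  addresses obtained are distinct.

  The same bound on \<open>lam\<close> makes some weight of every point of \<open>\<Omega>\<close> at least \<open>1 - lam\<close>, so the
  point lies in the image of \<open>\<Omega>\<close> under the corresponding map. Hence \<open>\<Omega>\<close> is a fixed set of the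
  system, and it is the only nonempty compact one because the maps are contractions.
\<close>

section \<open>Distributing a series of weights greedily\<close>

text \<open>
  The demand \<open>b j\<close> is served position by position, the state \<open>s\<close> at position \<open>k\<close> recording what is
  still outstanding. Its sum equals the tail \<open>R k\<close> of the series, so by the tail condition some
  outstanding demand is at least the average \<open>R k / card J \<ge> w k\<close> and can absorb the next weight
  without becoming negative. All outstanding demands then lie between \<open>0\<close> and \<open>R k\<close>, and \<open>R k\<close>
  tends to \<open>0\<close>.
\<close>

lemma greedy_partition_of_series:
  fixes w :: "nat \<Rightarrow> real" and b :: "'a \<Rightarrow> real"
  assumes J: "finite J" "J \<noteq> {}"
    and w: "summable w" "\<And>k. 0 \<le> w k"
    and tail: "\<And>k. real (card J) * w k \<le> (\<Sum>l. w (l + k))"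
    and b: "\<And>j. j \<in> J \<Longrightarrow> 0 \<le> b j" "sum b J = suminf w"
  shows "\<exists>i. (\<forall>k. i k \<in> J) \<and> (\<forall>j\<in>J. (\<lambda>k. if i k = j then w k else 0) sums b j)"
proof -
  define R where "R k = (\<Sum>l. w (l + k))" for k
  have R_eq: "R k = suminf w - sum w {..<k}" for k
    unfolding R_def by (rule suminf_minus_initial_segment[OF w(1)])
  have R_Suc: "R (Suc k) = R k - w k" for k
    by (simp add: R_eq)
  have "(\<lambda>n. suminf w - sum w {..<n}) \<longlonglongrightarrow> suminf w - suminf w"
    by (intro tendsto_intros summable_LIMSEQ w(1))
  hence R_lim: "R \<longlonglongrightarrow> 0"
    by (simp add: R_eq[abs_def])
  define P where "P k s \<longleftrightarrow> (\<forall>j\<in>J. 0 \<le> s j) \<and> sum s J = R k" for k and s :: "'a \<Rightarrow> real"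
  define Q where "Q k s s' \<longleftrightarrow> (\<exists>j\<in>J. s' = s(j := s j - w k))" for k and s s' :: "'a \<Rightarrow> real"
  have step: "\<exists>s'. P (Suc k) s' \<and> Q k s s'" if s: "P k s" for k s
  proof -
    have "\<exists>j\<in>J. w k \<le> s j"
    proof (rule ccontr)
      assume "\<not> (\<exists>j\<in>J. w k \<le> s j)"
      hence "sum s J < sum (\<lambda>_. w k) J"
        using J by (intro sum_strict_mono) auto
      thus False
        using tail[of k] s by (simp add: P_def R_def)
    qed
    then obtain j where j: "j \<in> J" "w k \<le> s j" by blast
    have "sum (s(j := s j - w k)) J = (s j - w k) + sum s (J - {j})"
      by (subst sum.remove[OF J(1) j(1)]) (auto intro!: sum.cong)
    also have "\<dots> = R (Suc k)"
      using s sum.remove[OF J(1) j(1), of s] by (simp add: P_def R_Suc)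
    finally have "P (Suc k) (s(j := s j - w k))"
      using s j by (simp add: P_def)
    thus ?thesis
      using j(1) by (auto simp: Q_def)
  qed
  have "\<exists>f. f 0 = b \<and> (\<forall>k. P k (f k)) \<and> (\<forall>k. Q k (f k) (f (Suc k)))"
  proof -
    define step_from where "step_from k s = (SOME s'. P (Suc k) s' \<and> Q k s s')" for k s
    define f where "f = rec_nat b step_from"
    have Pf: "P k (f k)" for k
    proof (induction k)
      case 0
      then show ?case using b by (simp add: f_def P_def R_def)
    next
      case (Suc k)
      then show ?case
        using someI_ex[OF step[OF Suc]] by (simp add: f_def step_from_def)
    qed
    have "Q k (f k) (f (Suc k))" for k
      using someI_ex[OF step[OF Pf[of k]]] by (simp add: f_def step_from_def)
    moreover have "f 0 = b" by (simp add: f_def)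
    ultimately show ?thesis using Pf by blast
  qed
  then obtain f where f: "f 0 = b" "\<And>k. P k (f k)" "\<And>k. Q k (f k) (f (Suc k))"
    by blast
  obtain i where i: "\<And>k. i k \<in> J" "\<And>k. f (Suc k) = (f k)(i k := f k (i k) - w k)"
    using f(3) unfolding Q_def by metis
  have "(\<lambda>k. if i k = j then w k else 0) sums b j" if j: "j \<in> J" for j
  proof -
    have partial: "(\<Sum>k<n. if i k = j then w k else 0) = b j - f n j" for n
      by (induction n) (auto simp: f(1) i(2))
    have "f n j \<le> R n" for n
      using f(2)[of n] member_le_sum[OF j, of "f n"] J(1) by (auto simp: P_def)
    hence "(\<lambda>n. f n j) \<longlonglongrightarrow> 0"
      using f(2) j by (intro tendsto_sandwich[OF _ _ tendsto_const R_lim]) (auto simp: P_def)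
    hence "(\<lambda>n. b j - f n j) \<longlonglongrightarrow> b j - 0"
      by (intro tendsto_intros)
    thus ?thesis
      by (simp add: sums_def partial)
  qed
  thus ?thesis using i(1) by blast
qed

section \<open>Continuum many digit sequences with prescribed digit weights\<close>

lemma sums_geometric_weights:
  fixes lam :: real
  assumes "0 < lam" "lam < 1"
  shows "(\<lambda>k. (1 - lam) * lam ^ (k + n)) sums lam ^ n"
proof -
  have "(\<lambda>k. ((1 - lam) * lam ^ n) * lam ^ k) sums (((1 - lam) * lam ^ n) * (1 / (1 - lam)))"
    using assms by (intro sums_mult geometric_sums) auto
  thus ?thesis
    using assms by (simp add: power_add mult_ac)
qed

text \<open>
  The free positions are the even ones from \<open>2 * K\<close> on, with \<open>K\<close> so large that their total weight is
  below both \<open>a u\<close> and \<open>a v\<close>. The digit at \<open>2 * (K + q)\<close> is \<open>u\<close> or \<open>v\<close> according to whether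
  \<open>q \<in> B\<close>. The greedy choice runs with the weights \<open>w\<close>, which are the geometric ones with those of
  the free positions replaced by \<open>0\<close>, so that the digits it proposes there may be overwritten.
\<close>

lemma exists_injective_family_of_digit_sequences:
  fixes lam :: real and a :: "'a \<Rightarrow> real"
  assumes V: "finite V"
    and lam: "0 < lam" "lam < 1" "2 * real (card V) * (1 - lam) \<le> 1"
    and a: "\<And>v. v \<in> V \<Longrightarrow> 0 \<le> a v" "sum a V = 1"
    and two: "u \<in> V" "v \<in> V" "u \<noteq> v" "0 < a u" "0 < a v"
  shows "\<exists>D :: nat set \<Rightarrow> nat \<Rightarrow> 'a. inj D \<and> (\<forall>B. (\<forall>k. D B k \<in> V) \<and>
           (\<forall>z\<in>V. (\<lambda>k. if D B k = z then (1 - lam) * lam ^ k else 0) sums a z))"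
proof -
  define g where "g k = (1 - lam) * lam ^ k" for k :: nat
  have g_pos: "0 \<le> g k" for k using lam by (simp add: g_def)
  have g_sums: "(\<lambda>k. g (k + n)) sums lam ^ n" for n
    using sums_geometric_weights[OF lam(1,2)] by (simp add: g_def)
  have g_Suc: "g (Suc k) \<le> g k" for k
    using lam by (auto simp: g_def intro!: mult_left_mono mult_left_le_one_le)
  obtain K where K: "lam ^ K < min (a u) (a v)"
    using real_arch_pow_inv[of "min (a u) (a v)" lam] two lam by auto
  define F where "F = {k. even k \<and> K \<le> k div 2}"
  define free where "free k = (if k \<in> F then g k else 0)" for k
  define w where "w k = (if k \<in> F then 0 else g k)" for k
  have free_le: "0 \<le> free k" "free k \<le> g k" and w_le: "0 \<le> w k" "w k \<le> g k" for k
    using g_pos[of k] by (auto simp: free_def w_def)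
  have sg: "summable (\<lambda>k. g (k + n))" for n
    using g_sums sums_summable by blast
  have sfree: "summable (\<lambda>k. free (k + n))" for n
    by (rule summable_comparison_test_ev[OF _ sg[of n]]) (use free_le in auto)
  have sw: "summable (\<lambda>k. w (k + n))" for n
    by (rule summable_comparison_test_ev[OF _ sg[of n]]) (use w_le in auto)
  have split: "suminf (\<lambda>k. w (k + n)) + suminf (\<lambda>k. free (k + n)) = lam ^ n" for n
  proof -
    have "suminf (\<lambda>k. w (k + n)) + suminf (\<lambda>k. free (k + n)) = suminf (\<lambda>k. w (k + n) + free (k + n))"
      by (rule suminf_add[OF sw sfree])
    also have "\<dots> = suminf (\<lambda>k. g (k + n))"
      by (intro suminf_cong) (auto simp: w_def free_def)
    finally show ?thesis using sums_unique[OF g_sums[of n]] by simp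
  qed
  have tail: "real (card V) * w k \<le> (\<Sum>l. w (l + k))" for k
  proof (cases "k \<in> F")
    case True
    hence "w k = 0" by (simp add: w_def)
    thus ?thesis using suminf_nonneg[OF sw w_le(1)] by simp
  next
    case False
    \<comment> \<open>No two consecutive positions are free, so each free weight after \<open>k\<close> is dominated by the
        weight \<open>w\<close> just before it; the weights \<open>w\<close> thus make up at least half of the tail.\<close>
    have "(\<Sum>l. free (l + k)) = (\<Sum>l. free (Suc l + k))"
      using suminf_split_head[OF sfree[of k]] False by (simp add: free_def)
    also have "\<dots> \<le> (\<Sum>l. w (l + k))"
    proof (rule suminf_le)
      show "free (Suc l + k) \<le> w (l + k)" for l
        using g_Suc[of "l + k"] w_le(1)[of "l + k"] by (auto simp: free_def w_def F_def)
      show "summable (\<lambda>l. free (Suc l + k))"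
        using sfree[of "Suc k"] by simp
    qed (rule sw)
    finally have "lam ^ k \<le> 2 * (\<Sum>l. w (l + k))"
      using split[of k] by simp
    moreover have "2 * (real (card V) * w k) \<le> lam ^ k"
      using mult_right_mono[OF lam(3), of "lam ^ k"] lam(1) False
      by (simp add: w_def g_def mult_ac)
    ultimately show ?thesis by linarith
  qed
  have free_small: "suminf free < min (a u) (a v)"
  proof -
    have "free k = 0" if "k < K" for k
      using that by (auto simp: free_def F_def)
    hence "suminf free = (\<Sum>k. free (k + K))"
      using suminf_split_initial_segment[OF sfree[of 0, simplified], of K] by simp
    also have "\<dots> \<le> (\<Sum>k. g (k + K))"
      by (rule suminf_le[OF _ sfree sg]) (use free_le in auto)
    also have "\<dots> = lam ^ K" using sums_unique[OF g_sums[of K]] by simp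
    finally show ?thesis using K by linarith
  qed
  have ex: "\<exists>i. (\<forall>k. i k \<in> V) \<and>
              (\<forall>z\<in>V. (\<lambda>k. if i k = z then g k else 0) sums a z) \<and>
              (\<forall>q. i (2 * (K + q)) = (if q \<in> B then u else v))" for B
  proof -
    define c where "c k = (if k div 2 - K \<in> B then u else v)" for k
    define part where "part z k = (if c k = z then free k else 0)" for z k
    have part_le: "0 \<le> part z k" "part z k \<le> free k" for z k
      using free_le[of k] by (auto simp: part_def)
    have spart: "summable (part z)" for z
      by (rule summable_comparison_test_ev[OF _ sfree[of 0]]) (use part_le in auto)
    have part_other: "part z = (\<lambda>_. 0)" if "z \<noteq> u" "z \<noteq> v" for z
      using that by (auto simp: part_def c_def fun_eq_iff)
    \<comment> \<open>What the greedy choice still has to provide once the free positions are filled.\<close>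
    define b where "b z = a z - suminf (part z)" for z
    have b_nonneg: "0 \<le> b z" if "z \<in> V" for z
    proof (cases "z = u \<or> z = v")
      case True
      have "suminf (part z) \<le> suminf free"
        using suminf_le[OF part_le(2) spart] sfree[of 0] by simp
      thus ?thesis using True free_small by (auto simp: b_def)
    qed (use a that part_other in \<open>auto simp: b_def\<close>)
    have "(\<Sum>z\<in>V. suminf (part z)) = suminf (\<lambda>k. \<Sum>z\<in>V. part z k)"
      using suminf_sum[of V part] spart by simp
    also have "(\<lambda>k. \<Sum>z\<in>V. part z k) = free"
      using V two by (auto simp: part_def c_def fun_eq_iff)
    finally have b_sum: "sum b V = suminf w"
      using split[of 0] a(2) by (simp add: b_def sum_subtractf)
    obtain i where i: "\<And>k. i k \<in> V"
        "\<And>z. z \<in> V \<Longrightarrow> (\<lambda>k. if i k = z then w k else 0) sums b z"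
      using greedy_partition_of_series[of V w b, OF V _ sw[of 0, simplified] w_le(1) tail b_nonneg b_sum] two(1)
      by blast
    define i' where "i' k = (if k \<in> F then c k else i k)" for k
    have "(\<lambda>k. if i' k = z then g k else 0) sums a z" if z: "z \<in> V" for z
    proof -
      have "(\<lambda>k. (if i k = z then w k else 0) + part z k) sums (b z + suminf (part z))"
        by (intro sums_add i(2) z summable_sums spart)
      moreover have "(\<lambda>k. (if i k = z then w k else 0) + part z k) = (\<lambda>k. if i' k = z then g k else 0)"
        by (auto simp: i'_def part_def w_def free_def)
      ultimately show ?thesis by (simp add: b_def)
    qed
    moreover have "i' k \<in> V" for k
      using i(1) two by (auto simp: i'_def c_def)
    moreover have "i' (2 * (K + q)) = (if q \<in> B then u else v)" for q
      by (simp add: i'_def c_def F_def)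
    ultimately show ?thesis by blast
  qed
  then obtain D where D: "\<And>B k. D B k \<in> V"
      "\<And>B z. z \<in> V \<Longrightarrow> (\<lambda>k. if D B k = z then g k else 0) sums a z"
      "\<And>B q. D B (2 * (K + q)) = (if q \<in> B then u else v)"
    by metis
  have "inj D"
  proof (rule injI)
    fix B C assume "D B = D C"
    hence "(if q \<in> B then u else v) = (if q \<in> C then u else v)" for q
      using D(3) by metis
    thus "B = C" using two(3) by (metis (full_types) set_eqI)
  qed
  thus ?thesis using D(1,2) unfolding g_def by blast
qed

section \<open>Addresses as digit expansions\<close>

lemma ifs_comp_eq_sum:
  "ifs_comp p lam i n x = lam ^ n *\<^sub>R x + (\<Sum>k<n. ((1 - lam) * lam ^ k) *\<^sub>R p (i k))"
  by (induction n arbitrary: x) (auto simp: ifs_map_def scaleR_add_right mult_ac)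

lemma is_address_if_sums:
  assumes lam: "0 < lam" "lam < 1" and i: "\<And>k. i k < m"
    and x: "(\<lambda>k. ((1 - lam) * lam ^ k) *\<^sub>R p (i k)) sums x"
  shows "is_address m p lam x i"
proof -
  have "(\<lambda>n. ifs_comp p lam i n y) \<longlonglongrightarrow> 0 *\<^sub>R y + x" for y
    unfolding ifs_comp_eq_sum
    using lam x by (intro tendsto_intros LIMSEQ_power_zero) (auto simp: sums_def)
  thus ?thesis using i by (simp add: is_address_def)
qed

text \<open>
  Sorting the terms of the digit expansion by the value of the digit turns a splitting of the weights
  into the barycentric representation.
\<close>

lemma sums_if_digit_weights:
  fixes d :: "nat \<Rightarrow> 'a::real_normed_vector"
  assumes V: "finite V" and d: "\<And>k. d k \<in> V"
    and total: "\<And>v. v \<in> V \<Longrightarrow> (\<lambda>k. if d k = v then w k else 0) sums a v"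
  shows "(\<lambda>k. w k *\<^sub>R d k) sums (\<Sum>v\<in>V. a v *\<^sub>R v)"
proof -
  have "(\<lambda>k. \<Sum>v\<in>V. (if d k = v then w k else 0) *\<^sub>R v) sums (\<Sum>v\<in>V. a v *\<^sub>R v)"
    by (intro sums_sum sums_scaleR_left total)
  moreover have "(\<Sum>v\<in>V. (if d k = v then w k else 0) *\<^sub>R v) = w k *\<^sub>R d k" for k
  proof -
    have "(\<Sum>v\<in>V. (if d k = v then w k else 0) *\<^sub>R v) = (\<Sum>v\<in>V. if d k = v then w k *\<^sub>R v else 0)"
      by (intro sum.cong) auto
    thus ?thesis using V d by simp
  qed
  ultimately show ?thesis by simp
qed

text \<open>A sequence is determined by its graph, coded as a set of naturals.\<close>

lemma lepoll_nat_sequences: "(S :: (nat \<Rightarrow> nat) set) \<lesssim> (UNIV :: nat set set)"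
proof -
  have "inj (\<lambda>i :: nat \<Rightarrow> nat. range (\<lambda>k. prod_encode (k, i k)))"
  proof (rule injI)
    fix i j :: "nat \<Rightarrow> nat"
    assume eq: "range (\<lambda>k. prod_encode (k, i k)) = range (\<lambda>k. prod_encode (k, j k))"
    show "i = j"
    proof
      fix k
      have "prod_encode (k, i k) \<in> range (\<lambda>k. prod_encode (k, j k))"
        using eq by blast
      thus "i k = j k" by (auto simp: prod_encode_eq)
    qed
  qed
  thus ?thesis
    unfolding lepoll_def by (meson inj_on_subset subset_UNIV)
qed

section \<open>Identifying the attractor\<close>

text \<open>
  Take a point \<open>x\<close> of \<open>S\<close> farthest from \<open>T\<close>. It is the image of some \<open>y \<in> S\<close>, and the map shrinks
  the distance from \<open>y\<close> to its nearest point of \<open>T\<close> by the factor \<open>lam\<close>, so the largest distance is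
  at most \<open>lam\<close> times itself and vanishes.
\<close>

lemma ifs_fixed_subset:
  fixes p :: "nat \<Rightarrow> 'a::real_normed_vector"
  assumes lam: "0 < lam" "lam < 1"
    and S: "compact S" "S \<subseteq> (\<Union>j<m. ifs_map p lam j ` S)"
    and T: "compact T" "T \<noteq> {}" "(\<Union>j<m. ifs_map p lam j ` T) \<subseteq> T"
  shows "S \<subseteq> T"
proof (cases "S = {}")
  case False
  have "continuous_on S (\<lambda>x. infdist x T)"
    by (intro continuous_intros)
  then obtain x where x: "x \<in> S" "\<And>y. y \<in> S \<Longrightarrow> infdist y T \<le> infdist x T"
    using continuous_attains_sup[OF S(1) False] by metis
  obtain j y where j: "j < m" "y \<in> S" "x = ifs_map p lam j y"
    using S(2) x(1) by blast
  have "continuous_on T (dist y)"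
    by (intro continuous_intros)
  then obtain t where t: "t \<in> T" "\<And>s. s \<in> T \<Longrightarrow> dist y t \<le> dist y s"
    using continuous_attains_inf[OF T(1,2)] by metis
  have nearest: "dist y t \<le> infdist y T"
    using T(2) t(2) by (auto simp: infdist_notempty intro: cINF_greatest)
  have "ifs_map p lam j t \<in> T" using T(3) t(1) j(1) by blast
  hence "infdist x T \<le> dist x (ifs_map p lam j t)" by (rule infdist_le)
  also have "\<dots> = lam * dist y t"
    using lam by (simp add: j(3) ifs_map_def dist_norm flip: scaleR_diff_right)
  also have "\<dots> \<le> lam * infdist x T"
    using lam(1) nearest x(2)[OF j(2)] by simp
  finally have "(1 - lam) * infdist x T \<le> 0" by (simp add: algebra_simps)
  hence "infdist x T \<le> 0" using lam by (simp add: mult_le_0_iff)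
  hence "infdist y T = 0" if "y \<in> S" for y
    using x(2)[OF that] infdist_nonneg[of y T] by linarith
  thus ?thesis
    using in_closed_iff_infdist_zero[OF compact_imp_closed[OF T(1)] T(2)] by blast
qed auto

lemma attractor_eqI:
  fixes p :: "nat \<Rightarrow> 'a::real_normed_vector"
  assumes lam: "0 < lam" "lam < 1"
    and S: "compact S" "S \<noteq> {}" "S = (\<Union>j<m. ifs_map p lam j ` S)"
  shows "attractor m p lam = S"
  unfolding attractor_def
proof (rule the_equality)
  fix T assume T: "compact T \<and> T \<noteq> {} \<and> T = (\<Union>j<m. ifs_map p lam j ` T)"
  show "T = S"
  proof (rule subset_antisym)
    show "T \<subseteq> S"
      by (rule ifs_fixed_subset[OF lam, where m = m and p = p]) (use S T in auto)
    show "S \<subseteq> T"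
      by (rule ifs_fixed_subset[OF lam, where m = m and p = p]) (use S T in auto)
  qed
qed (use S in blast)

text \<open>
  The largest of the \<open>card V\<close> weights of a point is at least \<open>1 - lam\<close>. Removing \<open>1 - lam\<close> from it and
  rescaling by \<open>1 / lam\<close> gives the weights of a preimage under the map belonging to that element of \<open>V\<close>.
\<close>

lemma convex_hull_subset_ifs_images:
  fixes p :: "nat \<Rightarrow> 'a::real_normed_vector"
  assumes lam: "0 < lam" "lam < 1" "real (card V) * (1 - lam) \<le> 1"
    and V: "finite V" "V \<subseteq> p ` {..<m}"
  shows "convex hull V \<subseteq> (\<Union>j<m. ifs_map p lam j ` (convex hull V))"
proof
  fix x assume "x \<in> convex hull V"
  then obtain a where a: "\<And>v. v \<in> V \<Longrightarrow> 0 \<le> a v" "sum a V = 1" "(\<Sum>v\<in>V. a v *\<^sub>R v) = x"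
    unfolding convex_hull_finite[OF V(1)] by blast
  have "\<exists>v\<in>V. 1 - lam \<le> a v"
  proof (rule ccontr)
    assume "\<not> ?thesis"
    moreover have "V \<noteq> {}" using a(2) by auto
    ultimately have "sum a V < sum (\<lambda>_. 1 - lam) V"
      using V by (intro sum_strict_mono) auto
    thus False using a(2) lam(3) by simp
  qed
  then obtain v where v: "v \<in> V" "1 - lam \<le> a v" by blast
  then obtain j where j: "j < m" "v = p j" using V(2) by blast
  define a' where "a' = (\<lambda>z. (a z - (if z = v then 1 - lam else 0)) / lam)"
  have "sum a' V = 1"
    using V(1) v(1) a(2) lam(1) by (simp add: a'_def sum_subtractf flip: sum_divide_distrib)
  moreover have "0 \<le> a' z" if "z \<in> V" for z
    using a(1)[OF that] v lam by (auto simp: a'_def)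
  ultimately have mem: "(\<Sum>z\<in>V. a' z *\<^sub>R z) \<in> convex hull V"
    unfolding convex_hull_finite[OF V(1)] by blast
  have "lam *\<^sub>R (\<Sum>z\<in>V. a' z *\<^sub>R z) = (\<Sum>z\<in>V. a z *\<^sub>R z - (if z = v then (1 - lam) *\<^sub>R v else 0))"
    unfolding scaleR_sum_right
    by (intro sum.cong) (use lam in \<open>auto simp: a'_def scaleR_diff_left\<close>)
  also have "\<dots> = x - (1 - lam) *\<^sub>R v"
    using V(1) v(1) a(3) by (simp add: sum_subtractf)
  finally have "x = ifs_map p lam j (\<Sum>z\<in>V. a' z *\<^sub>R z)"
    by (simp add: ifs_map_def j(2))
  thus "x \<in> (\<Union>j<m. ifs_map p lam j ` (convex hull V))"
    using mem j(1) by blast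
qed

lemma ifs_images_subset_convex:
  assumes "0 \<le> lam" "lam \<le> 1" "convex C" "p ` {..<m} \<subseteq> C"
  shows "(\<Union>j<m. ifs_map p lam j ` C) \<subseteq> C"
  using assms by (auto simp: ifs_map_def image_subset_iff intro!: convexD)

section \<open>Addresses of the points that are not vertices\<close>

text \<open>
  A single positive weight would have to be \<open>1\<close>, making the point a member of \<open>V\<close>. This is where it
  matters that \<open>V\<close> contains only vertices: a generator \<open>p j\<close> that is not a vertex can be represented
  by itself alone.
\<close>

lemma two_positive_weights_if_not_extreme:
  fixes a :: "'a::real_vector \<Rightarrow> real"
  assumes V: "finite V" "\<And>v. v \<in> V \<Longrightarrow> v extreme_point_of C"
    and a: "\<And>v. v \<in> V \<Longrightarrow> 0 \<le> a v" "sum a V = 1"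
    and x: "\<not> (\<Sum>v\<in>V. a v *\<^sub>R v) extreme_point_of C"
  shows "\<exists>u\<in>V. \<exists>v\<in>V. u \<noteq> v \<and> 0 < a u \<and> 0 < a v"
proof (rule ccontr)
  assume neg: "\<not> ?thesis"
  obtain u where u: "u \<in> V" "a u \<noteq> 0"
    using a(2) by (metis sum.neutral zero_neq_one)
  have z: "a v = 0" if "v \<in> V - {u}" for v
    using neg u a(1)[of u] a(1)[of v] that by force
  have "a u = 1"
    using a(2) sum.remove[OF V(1) u(1), of a] z by simp
  hence "(\<Sum>v\<in>V. a v *\<^sub>R v) = u"
    using sum.remove[OF V(1) u(1), of "\<lambda>v. a v *\<^sub>R v"] z by simp
  thus False using x V(2)[OF u(1)] by simp
qed

theorem theorem2p7:
  fixes m :: nat and p :: "nat \<Rightarrow> real ^ 'd" and \<Omega> :: "(real ^ 'd) set"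
  assumes distinct: "inj_on p {..<m}"
    and hull: "\<Omega> = convex hull (p ` {..<m})"
    and full_dim: "aff_dim \<Omega> = int CARD('d)"
  shows "\<exists>lam0::real. 0 \<le> lam0 \<and> lam0 < 1 \<and>
           (\<forall>lam. lam0 < lam \<and> lam < 1 \<longrightarrow>
              attractor m p lam = \<Omega> \<and>
              (\<forall>x\<in>\<Omega>. \<not> x extreme_point_of \<Omega> \<longrightarrow>
                 {i. is_address m p lam x i} \<approx> (UNIV :: nat set set)))"
proof -
  define V where "V = {v. v extreme_point_of \<Omega>}"
  have comp: "compact \<Omega>" and conv: "convex \<Omega>"
    by (auto simp: hull finite_imp_compact_convex_hull)
  have ne: "\<Omega> \<noteq> {}" using full_dim by auto
  have V_sub: "V \<subseteq> p ` {..<m}"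
    unfolding V_def hull by (rule extreme_points_of_convex_hull)
  have V_fin: "finite V" using V_sub finite_subset by blast
  have V_hull: "\<Omega> = convex hull V"
    unfolding V_def by (rule Krein_Milman_Minkowski[OF comp conv])
  have V_ne: "V \<noteq> {}" using ne V_hull by auto
  have card: "0 < card V" using V_ne V_fin by (simp add: card_gt_0_iff)
  have main: "attractor m p lam = \<Omega>"
    "x \<in> \<Omega> \<Longrightarrow> \<not> x extreme_point_of \<Omega> \<Longrightarrow> {i. is_address m p lam x i} \<approx> (UNIV :: nat set set)"
    if lam: "1 - 1 / (2 * real (card V)) < lam" "lam < 1" for lam x
  proof -
    have "1 / (2 * real (card V)) \<le> 1 / 2" using card by (simp add: field_simps)
    hence lam0: "0 < lam" using lam by linarith
    have half: "2 * real (card V) * (1 - lam) \<le> 1"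
      using lam(1) card by (simp add: field_simps)
    hence one: "real (card V) * (1 - lam) \<le> 1"
      using lam(2) mult_nonneg_nonneg[of "real (card V)" "1 - lam"] by linarith
    have "\<Omega> = (\<Union>j<m. ifs_map p lam j ` \<Omega>)"
    proof (rule subset_antisym)
      show "\<Omega> \<subseteq> (\<Union>j<m. ifs_map p lam j ` \<Omega>)"
        unfolding V_hull by (rule convex_hull_subset_ifs_images[OF lam0 lam(2) one V_fin V_sub])
      show "(\<Union>j<m. ifs_map p lam j ` \<Omega>) \<subseteq> \<Omega>"
        using lam0 lam(2) conv by (intro ifs_images_subset_convex) (auto simp: hull hull_inc)
    qed
    thus "attractor m p lam = \<Omega>"
      by (rule attractor_eqI[OF lam0 lam(2) comp ne])
    assume x: "x \<in> \<Omega>" "\<not> x extreme_point_of \<Omega>"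
    then obtain a where a: "\<And>v. v \<in> V \<Longrightarrow> 0 \<le> a v" "sum a V = 1" "(\<Sum>v\<in>V. a v *\<^sub>R v) = x"
      unfolding V_hull convex_hull_finite[OF V_fin] by blast
    obtain u v where uv: "u \<in> V" "v \<in> V" "u \<noteq> v" "0 < a u" "0 < a v"
      using two_positive_weights_if_not_extreme[OF V_fin _ a(1,2), of \<Omega>] x(2) a(3)
      by (auto simp: V_def)
    obtain D :: "nat set \<Rightarrow> nat \<Rightarrow> real ^ 'd" where D: "inj D" "\<And>B k. D B k \<in> V"
        "\<And>B z. z \<in> V \<Longrightarrow> (\<lambda>k. if D B k = z then (1 - lam) * lam ^ k else 0) sums a z"
      using exists_injective_family_of_digit_sequences[OF V_fin lam0 lam(2) half a(1,2) uv] by metis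
    define E where "E B k = inv_into {..<m} p (D B k)" for B k
    have E: "E B k < m" "p (E B k) = D B k" for B k
    proof -
      have "D B k \<in> p ` {..<m}" using D(2) V_sub by blast
      thus "E B k < m" "p (E B k) = D B k"
        using inv_into_into[of "D B k" p "{..<m}"] f_inv_into_f[of "D B k" p "{..<m}"]
        by (auto simp: E_def)
    qed
    have "inj E"
    proof (rule injI)
      fix B C assume "E B = E C"
      hence "D B = D C" using E(2) by (metis ext)
      thus "B = C" using D(1) by (simp add: inj_eq)
    qed
    moreover have "is_address m p lam x (E B)" for B
    proof (rule is_address_if_sums[OF lam0 lam(2) E(1)])
      show "(\<lambda>k. ((1 - lam) * lam ^ k) *\<^sub>R p (E B k)) sums x"
        unfolding E(2) a(3)[symmetric]
        by (rule sums_if_digit_weights[OF V_fin D(2) D(3)])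
    qed
    ultimately have "(UNIV :: nat set set) \<lesssim> {i. is_address m p lam x i}"
      unfolding lepoll_def by blast
    thus "{i. is_address m p lam x i} \<approx> (UNIV :: nat set set)"
      by (intro lepoll_antisym lepoll_nat_sequences)
  qed
  show ?thesis
  proof (intro exI[of _ "1 - 1 / (2 * real (card V))"] conjI allI impI ballI)
    show "0 \<le> 1 - 1 / (2 * real (card V))" "1 - 1 / (2 * real (card V)) < 1"
      using card by (auto simp: field_simps)
  qed (use main in auto)
qed

end
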